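(* Let $F$ be a field of characteristic different from two. In dimension $4$ there are, up to isomorphism, exactly three nilpotent Lie algebras over $F$, and they are pairwise non-isomorphic: $L_{4,1}=L_{3,1}\oplus I$; $L_{4,2}=L_{3,2}\oplus I$; and $L_{4,3}$ with basis $e_1,\ldots,e_4$ and non-zero products $[e_1,e_2]=e_3$, $[e_1,e_3]=e_4$. Of these, $L_{4,1}$ and $L_{4,2}$ are CB-algebras, but $L_{4,3}$ is not.
   Context: A Lie algebra $L$ is a CB-algebra if, whenever $x,y\in L$ satisfy $[x,y]=0$, then $[[x,z],y]=0$ for all $z\in L$. $L_{3,1}$ is the three-dimensional abelian Lie algebra; $L_{3,2}$ is the three-dimensional Heisenberg Lie algebra with basis $e_1,e_2,e_3$ and non-zero product $[e_1,e_2]=e_3$; $I$ denotes a one-dimensional ideal (a one-dimensional abelian algebra) and $\oplus$ is the algebra direct sum. Only non-zero products of basis elements are listed, with $[e_j,e_i]=-[e_i,e_j]$ understood. *)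

theory Defs
  imports "HOL-Analysis.Analysis"
begin

record ('f, 'v) lie_alg =
  smul :: "'f \<Rightarrow> 'v \<Rightarrow> 'v"
  brk :: "'v \<Rightarrow> 'v \<Rightarrow> 'v"

locale lie_algebra = vector_space "smul L"
  for L :: "('f::field, 'v::ab_group_add) lie_alg" (structure) +
  assumes brk_linear_right: "Vector_Spaces.linear (smul L) (smul L) (\<lambda>y. brk L x y)"
    and brk_linear_left: "Vector_Spaces.linear (smul L) (smul L) (\<lambda>x. brk L x y)"
    and brk_alternating: "brk L x x = 0"
    and jacobi: "brk L x (brk L y z) + brk L y (brk L z x) + brk L z (brk L x y) = 0"
begin

primrec lower_central :: "nat \<Rightarrow> 'v set" where
  "lower_central 0 = UNIV"
| "lower_central (Suc n) = span {brk L x y |x y. x \<in> lower_central n}"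

definition nilpotent :: bool where
  "nilpotent \<longleftrightarrow> (\<exists>n. lower_central n = {0})"

definition CB :: bool where
  "CB \<longleftrightarrow> (\<forall>x y. brk L x y = 0 \<longrightarrow> (\<forall>z. brk L (brk L x z) y = 0))"

end

text \<open>For positive \<open>n\<close>, \<open>dim UNIV = n\<close> forces a finite basis, since infinite-dimensional
  spaces have \<open>dim UNIV = 0\<close>.\<close>

definition nilpotent_lie_algebra_of_dim ::
    "nat \<Rightarrow> ('f::field, 'v::ab_group_add) lie_alg \<Rightarrow> bool" where
  "nilpotent_lie_algebra_of_dim n L \<longleftrightarrow>
     lie_algebra L \<and> lie_algebra.nilpotent L \<and> vector_space.dim (smul L) UNIV = n"

definition lie_isomorphic ::
    "('f::field, 'v::ab_group_add) lie_alg \<Rightarrow> ('f, 'w::ab_group_add) lie_alg \<Rightarrow> bool" where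
  "lie_isomorphic L M \<longleftrightarrow>
     (\<exists>\<phi>. Vector_Spaces.linear (smul L) (smul M) \<phi> \<and> bij \<phi> \<and>
          (\<forall>x y. \<phi> (brk L x y) = brk M (\<phi> x) (\<phi> y)))"

definition direct_sum ::
    "('f, 'v) lie_alg \<Rightarrow> ('f, 'w) lie_alg \<Rightarrow> ('f, 'v \<times> 'w) lie_alg" where
  "direct_sum L M =
     \<lparr>smul = (\<lambda>c (x, y). (smul L c x, smul M c y)),
      brk = (\<lambda>(x, y) (x', y'). (brk L x x', brk M y y'))\<rparr>"

definition abelian_alg :: "('f \<Rightarrow> 'v \<Rightarrow> 'v) \<Rightarrow> ('f, 'v::zero) lie_alg" where
  "abelian_alg s = \<lparr>smul = s, brk = (\<lambda>x y. 0)\<rparr>"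

text \<open>The algebra on \<open>'f ^ 'n\<close> given by a table \<open>P\<close> of products of basis vectors, where
  \<open>P i j\<close> is zero unless the product of the \<open>i\<close>-th and \<open>j\<close>-th basis vector is listed,
  and at most one of \<open>P i j\<close>, \<open>P j i\<close> is listed: the bracket is the bilinear extension of
  the antisymmetrized table \<open>P i j - P j i\<close>.\<close>

definition alg_of_products :: "('n \<Rightarrow> 'n \<Rightarrow> 'f ^ 'n) \<Rightarrow> ('f::field, 'f ^ 'n::finite) lie_alg" where
  "alg_of_products P =
     \<lparr>smul = (*s),
      brk = (\<lambda>x y. \<Sum>i\<in>UNIV. \<Sum>j\<in>UNIV. (x $ i * y $ j) *s (P i j - P j i))\<rparr>"

abbreviation basis_vec :: "'n \<Rightarrow> 'f::field ^ 'n::finite" where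
  "basis_vec i \<equiv> axis i 1"

definition line_alg :: "('f::field, 'f) lie_alg" where
  "line_alg = abelian_alg (*)"

definition L31 :: "('f::field, 'f ^ 3) lie_alg" where
  "L31 = abelian_alg (*s)"

text \<open>In the index types \<open>3\<close> and \<open>4\<close> the top index \<open>3\<close>, respectively \<open>4\<close>, is the element \<open>0\<close>;
  \<open>1, 2, 3\<close> and \<open>1, 2, 3, 4\<close> enumerate them without repetition.\<close>

definition L32 :: "('f::field, 'f ^ 3) lie_alg" where
  "L32 = alg_of_products (\<lambda>i j. if (i, j) = (1, 2) then basis_vec 3 else 0)"

definition L41 :: "('f::field, ('f ^ 3) \<times> 'f) lie_alg" where
  "L41 = direct_sum L31 line_alg"

definition L42 :: "('f::field, ('f ^ 3) \<times> 'f) lie_alg" where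
  "L42 = direct_sum L32 line_alg"

definition L43 :: "('f::field, 'f ^ 4) lie_alg" where
  "L43 = alg_of_products
     (\<lambda>i j. if (i, j) = (1, 2) then basis_vec 3 else if (i, j) = (1, 3) then basis_vec 4 else 0)"

end

theory Submission
  imports Defs
begin

text \<open>Let \<open>L\<close> be nilpotent of dimension four and not abelian. If all double products vanish, take
  \<open>z = [x, y] \<noteq> 0\<close> and complete \<open>x, y, z\<close> to a basis: since \<open>z\<close> is central, the fourth basis vector can
  be corrected by multiples of \<open>x\<close> and \<open>y\<close> to become central, which gives \<open>L\<^sub>4\<^sub>,\<^sub>2\<close>.
  Otherwise choose \<open>u = [a, b]\<close> in the second center and \<open>v\<close> with \<open>t = [u, v] \<noteq> 0\<close>.
  Then \<open>a, b, u, t\<close> is a basis in which the center is spanned by \<open>t\<close>, so \<open>[a, u]\<close> and \<open>[b, u]\<close> are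
  multiples of \<open>t\<close>, not both zero, and a change of \<open>a, b\<close> gives \<open>L\<^sub>4\<^sub>,\<^sub>3\<close>.
  The nilpotency class tells the three algebras apart; class at most two implies the CB property,
  while \<open>x = y = e\<^sub>1\<close>, \<open>z = e\<^sub>2\<close> violate it in \<open>L\<^sub>4\<^sub>,\<^sub>3\<close>.\<close>

section \<open>Vector spaces of equal positive dimension\<close>

text \<open>\<open>dim\<close> is the cardinality of a basis and infinite sets have
  \<open>card\<close> 0, so a positive dimension yields a finite basis. This gives access to the
  finite-dimensional locales.\<close>

lemma finite_dimensional_if_dim_pos:
  assumes "vector_space s" and "vector_space.dim s UNIV > 0"
  obtains B where "finite_dimensional_vector_space s B"
proof -
  interpret vector_space s by fact
  obtain B where "independent B" "UNIV \<subseteq> span B" "card B = dim UNIV"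
    using basis_exists by blast
  with assms(2) have "finite_dimensional_vector_space s B"
    by unfold_locales (auto intro: card_ge_0_finite)
  then show ?thesis ..
qed

lemma linear_inj_imp_bij:
  assumes lin: "Vector_Spaces.linear s1 s2 f" and "inj f"
    and dim: "vector_space.dim s1 UNIV = vector_space.dim s2 UNIV" "vector_space.dim s2 UNIV > 0"
  shows "bij f"
proof -
  interpret f: Vector_Spaces.linear s1 s2 f by fact
  obtain B1 B2 where "finite_dimensional_vector_space s1 B1" "finite_dimensional_vector_space s2 B2"
    using finite_dimensional_if_dim_pos f.vs1.vector_space_axioms f.vs2.vector_space_axioms dim
    by metis
  then interpret finite_dimensional_vector_space_pair s1 B1 s2 B2
    by (rule finite_dimensional_vector_space_pair.intro)
  show ?thesis
    using linear_injective_imp_surjective[OF lin \<open>inj f\<close> dim(1)[symmetric]] \<open>inj f\<close>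
    by (simp add: bij_def)
qed

lemma linear_bij_exists:
  assumes "vector_space s1" "vector_space s2"
    and dim: "vector_space.dim s1 UNIV = vector_space.dim s2 UNIV" "vector_space.dim s2 UNIV > 0"
  shows "\<exists>f. Vector_Spaces.linear s1 s2 f \<and> bij f"
proof -
  obtain B1 B2 where "finite_dimensional_vector_space s1 B1" "finite_dimensional_vector_space s2 B2"
    using finite_dimensional_if_dim_pos assms by metis
  then interpret finite_dimensional_vector_space_pair s1 B1 s2 B2
    by (rule finite_dimensional_vector_space_pair.intro)
  show ?thesis
    using subspace_isomorphism[OF vs1.subspace_UNIV vs2.subspace_UNIV dim(1)]
    by (auto simp: bij_def)
qed

lemma linear_inv:
  assumes "Vector_Spaces.linear s1 s2 f" "bij f"
  shows "Vector_Spaces.linear s2 s1 (inv f)"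
proof -
  interpret f: Vector_Spaces.linear s1 s2 f by fact
  show ?thesis
    unfolding Vector_Spaces.linear_iff
    using assms(2) f.vs1.vector_space_axioms f.vs2.vector_space_axioms
    by (auto intro!: inv_f_eq[OF bij_is_inj] simp: f.add f.scale bij_is_surj surj_f_inv_f)
qed


section \<open>Lie algebras\<close>

text \<open>Maps out of a model algebra are easy to write down in coordinates, so isomorphisms onto
  the models are built backwards and then inverted.\<close>

lemma lie_isomorphic_if_inverse:
  assumes lin: "Vector_Spaces.linear (smul M) (smul L) \<psi>" and "bij \<psi>"
    and hom: "\<And>x y. \<psi> (brk M x y) = brk L (\<psi> x) (\<psi> y)"
  shows "lie_isomorphic L M"
  unfolding lie_isomorphic_def
proof (intro exI conjI allI)
  show "Vector_Spaces.linear (smul L) (smul M) (inv \<psi>)" "bij (inv \<psi>)"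
    using assms by (simp_all add: linear_inv bij_imp_bij_inv)
  fix x y
  show "inv \<psi> (brk L x y) = brk M (inv \<psi> x) (inv \<psi> y)"
    using \<open>bij \<psi>\<close> by (intro inv_f_eq) (simp_all add: hom bij_is_inj bij_is_surj surj_f_inv_f)
qed

context lie_algebra
begin

lemma brk_right:
  "brk L x (y + z) = brk L x y + brk L x z" "brk L x (smul L c y) = smul L c (brk L x y)"
  "brk L x (- y) = - brk L x y" "brk L x (y - z) = brk L x y - brk L x z" "brk L x 0 = 0"
proof -
  interpret r: Vector_Spaces.linear "smul L" "smul L" "brk L x" by (rule brk_linear_right)
  show "brk L x (y + z) = brk L x y + brk L x z" "brk L x (smul L c y) = smul L c (brk L x y)"
    "brk L x (- y) = - brk L x y" "brk L x (y - z) = brk L x y - brk L x z" "brk L x 0 = 0"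
    by (rule r.add r.scale r.neg r.diff r.zero)+
qed

lemma brk_left:
  "brk L (y + z) x = brk L y x + brk L z x" "brk L (smul L c y) x = smul L c (brk L y x)"
  "brk L (- y) x = - brk L y x" "brk L (y - z) x = brk L y x - brk L z x" "brk L 0 x = 0"
proof -
  interpret l: Vector_Spaces.linear "smul L" "smul L" "\<lambda>y. brk L y x" by (rule brk_linear_left)
  show "brk L (y + z) x = brk L y x + brk L z x" "brk L (smul L c y) x = smul L c (brk L y x)"
    "brk L (- y) x = - brk L y x" "brk L (y - z) x = brk L y x - brk L z x" "brk L 0 x = 0"
    by (rule l.add l.scale l.neg l.diff l.zero)+
qed

lemma brk_antisym: "brk L y x = - brk L x y"
proof -
  have "brk L (x + y) (x + y) = brk L x y + brk L y x"
    by (simp only: brk_left brk_right brk_alternating[of x] brk_alternating[of y]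
        add_0_left add_0_right add.commute)
  then show ?thesis
    by (simp only: brk_alternating eq_neg_iff_add_eq_0 add.commute)
qed

section \<open>Nilpotency class and the lower central series\<close>

lemma nilpotent_if_class_le_3:
  assumes "\<And>x y z w. brk L (brk L (brk L x y) z) w = 0"
  shows nilpotent
proof -
  \<comment> \<open>The bounding sets, namely the elements killed by two further brackets and then
    by one, are subspaces, so it suffices to check generators.\<close>
  have "lower_central 1 \<subseteq> {x. \<forall>z w. brk L (brk L x z) w = 0}"
    unfolding One_nat_def lower_central.simps
    by (rule span_minimal) (auto simp: assms subspace_def brk_left)
  then have "lower_central 2 \<subseteq> {x. \<forall>w. brk L x w = 0}"
    unfolding numeral_2_eq_2 lower_central.simps One_nat_def[symmetric]
    by (intro span_minimal) (auto simp: subspace_def brk_left)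
  then have "lower_central 3 \<subseteq> {0}"
    unfolding numeral_3_eq_3 lower_central.simps(2)[of "Suc (Suc 0)"] numeral_2_eq_2
    by (intro span_minimal) auto
  moreover have "0 \<in> lower_central 3"
    by (simp add: numeral_3_eq_3 span_zero)
  ultimately show ?thesis
    unfolding nilpotent_def by blast
qed

text \<open>For the witness, look at the last two non-zero terms of the lower central series.\<close>

lemma nilpotent_class_ge_3E:
  assumes nilpotent and "brk L (brk L x y) z \<noteq> 0"
  obtains a b v where "brk L (brk L a b) v \<noteq> 0"
    and "\<And>w w'. brk L (brk L (brk L a b) w) w' = 0"
proof -
  define n where "n = (LEAST n. lower_central n = {0})"
  have n: "lower_central n = {0}"
    unfolding n_def by (rule LeastI_ex) (use assms(1) in \<open>simp add: nilpotent_def\<close>)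
  have below: "lower_central m \<noteq> {0}" if "m < n" for m
    using not_less_Least that unfolding n_def by blast
  have mem: "brk L a b \<in> lower_central (Suc k)" if "a \<in> lower_central k" for a b k
    using that by (auto intro!: span_base)
  \<comment> \<open>The series starts at index 0 with the whole space, so the non-zero double
    product lies in the term of index 2. Hence \<open>n\<close> is at least 3.\<close>
  have "n \<noteq> 0" "n \<noteq> 1" "n \<noteq> 2"
    using n mem[of _ 0] mem[of _ 1] assms(2) brk_left(5)
    by (auto simp: numeral_2_eq_2)
  then obtain k where k: "n = Suc (Suc (Suc k))"
    by (metis One_nat_def Suc_1 not0_implies_Suc)
  \<comment> \<open>Otherwise the term \<open>Suc k\<close> is central and the next one is already
    zero, against the minimality of \<open>n\<close>.\<close>
  have "\<exists>a\<in>lower_central k. \<exists>b v. brk L (brk L a b) v \<noteq> 0"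
  proof (rule ccontr)
    assume "\<not> ?thesis"
    then have "lower_central (Suc k) \<subseteq> {x. \<forall>w. brk L x w = 0}"
      unfolding lower_central.simps by (intro span_minimal) (auto simp: subspace_def brk_left)
    then have "lower_central (Suc (Suc k)) \<subseteq> {0}"
      unfolding lower_central.simps(2)[of "Suc k"] by (intro span_minimal) auto
    moreover have "0 \<in> lower_central (Suc (Suc k))"
      by (simp add: span_zero)
    ultimately show False
      using below[of "Suc (Suc k)"] k by blast
  qed
  then obtain a b v where a: "a \<in> lower_central k" and v: "brk L (brk L a b) v \<noteq> 0"
    by blast
  have "brk L (brk L (brk L a b) w) w' = 0" for w w'
    using mem[OF mem[OF mem[OF a]], of b w w'] n by (simp only: k singleton_iff)
  then show ?thesis by (rule that[OF v])
qed

section \<open>Coordinates in dimension four\<close>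

definition independent4 :: "'v \<Rightarrow> 'v \<Rightarrow> 'v \<Rightarrow> 'v \<Rightarrow> bool" where
  "independent4 e1 e2 e3 e4 \<longleftrightarrow>
     (\<forall>a b c d. smul L a e1 + smul L b e2 + smul L c e3 + smul L d e4 = 0
        \<longrightarrow> a = 0 \<and> b = 0 \<and> c = 0 \<and> d = 0)"

text \<open>The coefficient form of \<open>independent4\<close>, which also excludes repeated
  vectors, says exactly that the coordinate map has trivial kernel. Equality of dimensions then
  gives surjectivity.\<close>

lemma bij_coordinates:
  fixes e1 e2 e3 e4 :: 'v
  defines "\<psi> \<equiv> \<lambda>v :: 'f ^ 4. smul L (v $ 1) e1 + smul L (v $ 2) e2
    + smul L (v $ 3) e3 + smul L (v $ 4) e4"
  assumes dim: "dim UNIV = 4" and ind: "independent4 e1 e2 e3 e4"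
  shows "Vector_Spaces.linear (*s) (smul L) \<psi>" "bij \<psi>"
proof -
  show lin: "Vector_Spaces.linear (*s) (smul L) \<psi>"
    unfolding Vector_Spaces.linear_iff \<psi>_def
    by (simp add: vec.vector_space_axioms vector_space_axioms scale_left_distrib
        scale_right_distrib add_ac)
  interpret \<psi>: Vector_Spaces.linear "(*s)" "smul L" \<psi> by (rule lin)
  have "inj \<psi>"
    unfolding \<psi>.inj_iff_eq_0
    using ind unfolding \<psi>_def independent4_def by (simp add: vec_eq_iff forall_4)
  moreover have "vec.dim (UNIV :: ('f ^ 4) set) = 4"
    by (simp add: vec_dim_card del: vec.dim_UNIV)
  ultimately show "bij \<psi>"
    using linear_inj_imp_bij[OF lin] dim by (simp del: vec.dim_UNIV)
qed

lemma coordinatesE: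
  assumes "dim UNIV = 4" and "independent4 e1 e2 e3 e4"
  obtains a b c d where "x = smul L a e1 + smul L b e2 + smul L c e3 + smul L d e4"
  using bij_is_surj[OF bij_coordinates(2)[OF assms]] unfolding surj_def by metis

end


section \<open>The three model algebras\<close>

lemma smul_models:
  "smul L43 = (*s)" "smul L41 = (\<lambda>c (x, y). (c *s x, c * y))"
  "smul L42 = (\<lambda>c (x, y). (c *s x, c * y))"
  by (simp_all add: L43_def L41_def L42_def L31_def L32_def line_alg_def direct_sum_def
      abelian_alg_def alg_of_products_def)

lemma brk_L43:
  "brk L43 x y $ 1 = 0" "brk L43 x y $ 2 = 0"
  "brk L43 x y $ 3 = x $ 1 * y $ 2 - x $ 2 * y $ 1"
  "brk L43 x y $ 4 = x $ 1 * y $ 3 - x $ 3 * y $ 1"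
  by (simp_all add: L43_def alg_of_products_def sum_4 axis_def)

lemma brk_L42:
  "fst (brk L42 x y) $ 1 = 0" "fst (brk L42 x y) $ 2 = 0"
  "fst (brk L42 x y) $ 3 = fst x $ 1 * fst y $ 2 - fst x $ 2 * fst y $ 1"
  "snd (brk L42 x y) = 0"
  by (simp_all add: L42_def L32_def line_alg_def direct_sum_def abelian_alg_def
      alg_of_products_def sum_3 axis_def split: prod.splits)

lemma brk_L41: "brk L41 x y = 0"
  by (simp add: L41_def L31_def line_alg_def direct_sum_def abelian_alg_def zero_prod_def
      split: prod.splits)

lemma vector_space_smul_pair:
  "vector_space (\<lambda>c (x :: 'f::field ^ 3, y). (c *s x, c * y))"
  by unfold_locales (auto simp: algebra_simps vector_add_ldistrib vector_sadd_rdistrib)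

text \<open>This scaling is the one of the product of two finite-dimensional spaces, so the
  dimensions 3 and 1 add up.\<close>

lemma dim_smul_pair:
  "vector_space.dim (\<lambda>c (x :: 'f::field ^ 3, y). (c *s x, c * y)) UNIV = 4"
proof -
  interpret prod: finite_dimensional_vector_space_prod
    "(*s) :: 'f \<Rightarrow> 'f ^ 3 \<Rightarrow> 'f ^ 3" "(*) :: 'f \<Rightarrow> 'f \<Rightarrow> 'f" cart_basis "{1}"
    by unfold_locales
  have "prod.scale = (\<lambda>c (x, y). (c *s x, c * y))"
    by (intro ext) (simp add: prod.scale_def split_beta)
  moreover have "prod.p.dim (UNIV \<times> UNIV) = 4"
    using prod.dim_Times[OF vec.subspace_UNIV vector_space_over_itself.subspace_UNIV]
    by (simp add: card_cart_basis)
  ultimately show ?thesis by simp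
qed

lemma lie_algebra_models:
  "lie_algebra L41" "lie_algebra L42" "lie_algebra L43"
proof -
  show "lie_algebra L41"
    by (intro lie_algebra.intro lie_algebra_axioms.intro)
      (simp_all add: smul_models brk_L41 vector_space_smul_pair Vector_Spaces.linear_iff zero_prod_def)
  show "lie_algebra L42"
    by (intro lie_algebra.intro lie_algebra_axioms.intro)
      (simp_all add: smul_models brk_L42 vector_space_smul_pair Vector_Spaces.linear_iff
        prod_eq_iff vec_eq_iff forall_3 split_beta algebra_simps)
  show "lie_algebra L43"
    by (intro lie_algebra.intro lie_algebra_axioms.intro)
      (simp_all add: smul_models brk_L43 vec.vector_space_axioms Vector_Spaces.linear_iff
        vec_eq_iff forall_4 algebra_simps)
qed

lemma nilpotent_models:
  "nilpotent_lie_algebra_of_dim 4 L41" "nilpotent_lie_algebra_of_dim 4 L42"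
  "nilpotent_lie_algebra_of_dim 4 (L43 :: ('f::field, 'f ^ 4) lie_alg)"
  unfolding nilpotent_lie_algebra_of_dim_def
  by (auto simp: lie_algebra_models smul_models dim_smul_pair vec_dim_card brk_L41 brk_L42 brk_L43
      prod_eq_iff vec_eq_iff forall_3 forall_4 simp del: vec.dim_UNIV
      intro!: lie_algebra.nilpotent_if_class_le_3)


section \<open>Recognizing the model algebras\<close>

context lie_algebra
begin

text \<open>Both brackets vanish, so any linear bijection is an isomorphism.\<close>

lemma lie_isomorphic_L41:
  assumes "dim UNIV = 4" and "\<And>x y. brk L x y = 0"
  shows "lie_isomorphic L L41"
proof -
  have "vector_space.dim (smul L41) (UNIV :: (('f ^ 3) \<times> 'f) set) = 4" "vector_space (smul L41)"
    unfolding smul_models by (rule dim_smul_pair vector_space_smul_pair)+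
  with linear_bij_exists[OF vector_space_axioms this(2)] assms
  obtain \<phi> :: "'v \<Rightarrow> ('f ^ 3) \<times> 'f"
    where lin: "Vector_Spaces.linear (smul L) (smul L41) \<phi>" and "bij \<phi>"
    by auto
  interpret \<phi>: Vector_Spaces.linear "smul L" "smul L41" \<phi> by (rule lin)
  show ?thesis
    unfolding lie_isomorphic_def using lin \<open>bij \<phi>\<close> assms(2) \<phi>.zero by (auto simp: brk_L41)
qed

lemma lie_isomorphic_L42:
  assumes "dim UNIV = 4" and ind: "independent4 e1 e2 e3 e4"
    and brk: "brk L e1 e2 = e3" "brk L e1 e3 = 0" "brk L e2 e3 = 0"
      "brk L e1 e4 = 0" "brk L e2 e4 = 0" "brk L e3 e4 = 0"
  shows "lie_isomorphic L L42"
proof -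
  define \<psi> :: "('f ^ 3) \<times> 'f \<Rightarrow> 'v" where
    "\<psi> = (\<lambda>v. smul L (fst v $ 1) e1 + smul L (fst v $ 2) e2
      + smul L (fst v $ 3) e3 + smul L (snd v) e4)"
  have lin: "Vector_Spaces.linear (smul L42) (smul L) \<psi>"
    unfolding smul_models Vector_Spaces.linear_iff \<psi>_def
    by (simp add: vector_space_smul_pair vector_space_axioms scale_left_distrib
        scale_right_distrib add_ac split_beta)
  interpret \<psi>: Vector_Spaces.linear "smul L42" "smul L" \<psi> by (rule lin)
  have "inj \<psi>"
    unfolding \<psi>.inj_iff_eq_0 using ind unfolding \<psi>_def independent4_def
    by (auto simp: prod_eq_iff vec_eq_iff forall_3)
  then have "bij \<psi>"
    using linear_inj_imp_bij[OF lin] assms(1) by (simp add: smul_models dim_smul_pair)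
  have brk': "brk L e2 e1 = - e3" "brk L e3 e1 = 0" "brk L e3 e2 = 0"
      "brk L e4 e1 = 0" "brk L e4 e2 = 0" "brk L e4 e3 = 0"
    using brk_antisym[of e2 e1] brk_antisym[of e3 e1] brk_antisym[of e3 e2]
      brk_antisym[of e4 e1] brk_antisym[of e4 e2] brk_antisym[of e4 e3] by (simp_all add: brk)
  show ?thesis
    by (rule lie_isomorphic_if_inverse[OF lin \<open>bij \<psi>\<close>])
      (simp add: \<psi>_def brk_L42 brk_left brk_right brk brk' brk_alternating
        scale_left_diff_distrib mult.commute)
qed

text \<open>The products together with \<open>e4 \<noteq> 0\<close> force independence, since
  brackets with \<open>e1\<close> and \<open>e2\<close> isolate the coefficients of a linear
  relation.\<close>

lemma lie_isomorphic_L43: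
  assumes dim: "dim UNIV = 4"
    and brk: "brk L e1 e2 = e3" "brk L e1 e3 = e4" "brk L e2 e3 = 0"
      "brk L e1 e4 = 0" "brk L e2 e4 = 0" "brk L e3 e4 = 0"
    and "e4 \<noteq> 0"
  shows "lie_isomorphic L L43"
proof -
  have brk': "brk L e2 e1 = - e3" "brk L e3 e1 = - e4" "brk L e3 e2 = 0"
      "brk L e4 e1 = 0" "brk L e4 e2 = 0" "brk L e4 e3 = 0"
    using brk_antisym[of e2 e1] brk_antisym[of e3 e1] brk_antisym[of e3 e2]
      brk_antisym[of e4 e1] brk_antisym[of e4 e2] brk_antisym[of e4 e3] by (simp_all add: brk)
  have "e3 \<noteq> 0"
    using brk \<open>e4 \<noteq> 0\<close> brk_right by metis
  have ind: "independent4 e1 e2 e3 e4"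
    unfolding independent4_def
  proof (intro allI impI)
    fix a b c d
    assume *: "smul L a e1 + smul L b e2 + smul L c e3 + smul L d e4 = 0" (is "?s = 0")
    \<comment> \<open>Bracketing with \<open>e1\<close> kills \<open>e1\<close> and
      \<open>e4\<close> and shifts \<open>e2\<close> to \<open>e3\<close> and \<open>e3\<close> to
      \<open>e4\<close>; doing it twice leaves only the \<open>b\<close> term.\<close>
    have "brk L e1 ?s = smul L b e3 + smul L c e4"
      by (simp only: brk_right brk brk_alternating scale_zero_right add_0_left add_0_right)
    then have bc: "smul L b e3 + smul L c e4 = 0"
      by (simp only: * brk_right)
    then have "brk L e1 (smul L b e3 + smul L c e4) = 0"
      by (simp only: brk_right)
    then have b: "b = 0"
      using \<open>e4 \<noteq> 0\<close> by (simp add: brk_right brk)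
    with bc \<open>e4 \<noteq> 0\<close> have c: "c = 0" by simp
    have "brk L ?s e2 = smul L a e3"
      by (simp add: brk_left brk brk' brk_alternating)
    then have a: "a = 0"
      using \<open>e3 \<noteq> 0\<close> by (simp add: * brk_left)
    show "a = 0 \<and> b = 0 \<and> c = 0 \<and> d = 0"
      using * \<open>e4 \<noteq> 0\<close> by (simp add: a b c)
  qed
  note \<psi> = bij_coordinates[OF dim ind]
  show ?thesis
    by (rule lie_isomorphic_if_inverse[OF \<psi>(1)[folded smul_models(1)] \<psi>(2)])
      (simp add: brk_L43 brk_left brk_right brk brk' brk_alternating scale_left_diff_distrib
        scale_minus_right mult.commute algebra_simps)
qed

text \<open>Replacing \<open>b\<close> by \<open>b - m a\<close> keeps the product with
  \<open>a\<close> equal to \<open>u\<close> and makes the second generator commute with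
  \<open>u\<close>.\<close>

lemma lie_isomorphic_L43_if_proportional:
  assumes dim: "dim UNIV = 4"
    and u: "brk L a b = u" "brk L b u = smul L m (brk L a u)" "brk L a u \<noteq> 0"
    and central: "\<And>w. brk L (brk L a u) w = 0"
  shows "lie_isomorphic L L43"
proof (rule lie_isomorphic_L43[OF dim, of a "b - smul L m a" u "brk L a u"])
  have central': "brk L w (brk L a u) = 0" for w
    using brk_antisym[of w] central by simp
  show "brk L a (b - smul L m a) = u" "brk L (b - smul L m a) u = 0"
    using u by (simp_all add: brk_left brk_right brk_alternating)
  show "brk L a (brk L a u) = 0" "brk L (b - smul L m a) (brk L a u) = 0" "brk L u (brk L a u) = 0"
    by (rule central')+
qed (use u in auto)

section \<open>Classes two and three in dimension four\<close>

lemma lie_isomorphic_L42_if_class_2: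
  assumes dim: "dim UNIV = 4" and "brk L x y \<noteq> 0"
    and class2: "\<And>x y z. brk L (brk L x y) z = 0"
  shows "lie_isomorphic L L42"
proof -
  define z where "z = brk L x y"
  have z: "brk L x y = z" "brk L y x = - z" "z \<noteq> 0"
    using assms(2) brk_antisym[of y x] by (simp_all add: z_def)
  have class2': "brk L w (brk L u v) = 0" for u v w
    using brk_antisym[of w] class2 by simp
  have central: "brk L z w = 0" "brk L w z = 0" for w
    unfolding z_def by (rule class2 class2')+
  have "span {x, y, z} \<noteq> UNIV"
  proof
    assume "span {x, y, z} = UNIV"
    then have "dim UNIV \<le> card {x, y, z}"
      by (intro dim_le_card) auto
    also have "\<dots> \<le> 3"
      by (simp add: card_insert_if)
    finally show False using dim by simp
  qed
  then obtain w where w: "w \<notin> span {x, y, z}" by auto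
  \<comment> \<open>Stated for every \<open>v\<close> outside the span because it is applied first
    to \<open>w\<close> and later to the corrected vector.\<close>
  have ind: "independent4 x y z v" if v: "v \<notin> span {x, y, z}" for v
    unfolding independent4_def
  proof (intro allI impI)
    fix a b c d
    assume *: "smul L a x + smul L b y + smul L c z + smul L d v = 0"
    have d: "d = 0"
    proof (rule ccontr)
      assume "d \<noteq> 0"
      have "smul L d v = - (smul L a x + smul L b y + smul L c z)"
        using * by (metis eq_neg_iff_add_eq_0 add.commute)
      also have "\<dots> \<in> span {x, y, z}"
        by (intro span_neg span_add span_scale span_base) auto
      finally have "smul L (inverse d) (smul L d v) \<in> span {x, y, z}"
        by (rule span_scale)
      with \<open>d \<noteq> 0\<close> v show False by simp
    qed
    \<comment> \<open>As \<open>z\<close> is central, bracketing with \<open>y\<close> leaves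
      \<open>a z\<close> and bracketing with \<open>x\<close> leaves \<open>b z\<close>.\<close>
    have "brk L (smul L a x + smul L b y + smul L c z) y = 0"
         "brk L x (smul L a x + smul L b y + smul L c z) = 0"
      using * by (simp_all only: d scale_zero_left add_0_right brk_left brk_right)
    then have "a = 0" "b = 0"
      using z by (simp_all add: brk_left brk_right brk_alternating central)
    then show "a = 0 \<and> b = 0 \<and> c = 0 \<and> d = 0"
      using * z by (simp add: d)
  qed
  \<comment> \<open>Bracket the expansion of \<open>[u, w]\<close> with \<open>x\<close> and with
    \<open>y\<close>; both results vanish as double products. If \<open>d = 0\<close> this kills
    \<open>a\<close> and \<open>b\<close>; otherwise the two equations can be solved for
    \<open>[x, w]\<close> and \<open>[y, w]\<close> as multiples of \<open>z\<close>.\<close>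
  have multiple: "\<exists>k. brk L u w = smul L k z" if "u = x \<or> u = y" for u
  proof -
    obtain a b c d where k: "brk L u w = smul L a x + smul L b y + smul L c z + smul L d w"
      using coordinatesE[OF dim ind[OF w]] by blast
    have "brk L x (brk L u w) = smul L b z + smul L d (brk L x w)"
         "brk L y (brk L u w) = - smul L a z + smul L d (brk L y w)"
      unfolding k by (simp_all add: brk_right brk_alternating z central)
    then have r: "smul L b z + smul L d (brk L x w) = 0" "- smul L a z + smul L d (brk L y w) = 0"
      by (simp_all add: class2')
    show ?thesis
    proof (cases "d = 0")
      case True
      with r z have "a = 0" "b = 0" by simp_all
      with True k show ?thesis by auto
    next
      case False
      have solve: "p = smul L (- (e / d)) z" if "smul L e z + smul L d p = 0" for p e
      proof -
        have "smul L d p = smul L (- e) z"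
          using that by (simp add: eq_neg_iff_add_eq_0 add.commute)
        then have "smul L (inverse d) (smul L d p) = smul L (inverse d) (smul L (- e) z)"
          by (rule arg_cong)
        with False show ?thesis by (simp add: field_simps)
      qed
      show ?thesis
        using solve[OF r(1)] solve[of "- a" "brk L y w"] r(2) that
        by (metis scale_minus_left)
    qed
  qed
  obtain k where k: "brk L x w = smul L k z"
    using multiple by blast
  obtain l where l: "brk L y w = smul L l z"
    using multiple by blast
  \<comment> \<open>Since \<open>[x, y] = z\<close> and \<open>[y, x] = -z\<close>, the term
    \<open>- k y\<close> cancels \<open>[x, w] = k z\<close> and the term \<open>l x\<close> cancels
    \<open>[y, w] = l z\<close>.\<close>
  define v where "v = w - smul L k y + smul L l x"
  have "v \<notin> span {x, y, z}"
  proof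
    assume "v \<in> span {x, y, z}"
    then have "v + smul L k y - smul L l x \<in> span {x, y, z}"
      by (intro span_add span_diff span_scale) (auto intro: span_base)
    with w show False by (simp add: v_def)
  qed
  moreover have "brk L x v = 0" "brk L y v = 0"
    by (simp_all add: v_def brk_right k l z brk_alternating)
  ultimately show ?thesis
    using lie_isomorphic_L42[OF dim ind] z(1) central by blast
qed

lemma lie_isomorphic_L43_if_class_3:
  assumes dim: "dim UNIV = 4" and v: "brk L (brk L a b) v \<noteq> 0"
    and class3: "\<And>w w'. brk L (brk L (brk L a b) w) w' = 0"
  shows "lie_isomorphic L L43"
proof -
  define u where "u = brk L a b"
  define t where "t = brk L u v"
  have t: "t \<noteq> 0" and t0: "\<And>w. brk L t w = 0" "\<And>w. brk L w t = 0"
    and uw: "\<And>w w'. brk L (brk L u w) w' = 0"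
    using v class3 brk_antisym[of _ t] by (simp_all add: u_def t_def)
  have wu: "brk L (brk L w u) w' = 0" for w w'
    using uw[of w w'] brk_antisym[of w u] by (simp add: brk_left)
  have ab: "brk L a b = u" "brk L b a = - u"
    using brk_antisym[of b a] by (simp_all add: u_def)
  text \<open>Bracketing with \<open>a\<close> or \<open>b\<close> and then with \<open>v\<close> reads off the coefficients of \<open>b\<close> and \<open>a\<close>.\<close>
  have central: "p = 0 \<and> q = 0 \<and> r = 0"
    if z: "\<And>w. brk L w (smul L p a + smul L q b + smul L r u + smul L s t) = 0" for p q r s
  proof -
    let ?z = "smul L p a + smul L q b + smul L r u + smul L s t"
    have "brk L (brk L a ?z) v = smul L q t" "brk L (brk L b ?z) v = - smul L p t"
      by (simp_all add: brk_right brk_left brk_alternating ab t0 wu flip: t_def)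
    then have pq: "p = 0" "q = 0"
      using t by (simp_all only: z brk_left, simp_all)
    \<comment> \<open>With \<open>p\<close> and \<open>q\<close> gone, bracketing with
      \<open>v\<close> itself isolates the coefficient of \<open>u\<close>.\<close>
    have "brk L v ?z = - smul L r t"
      using brk_antisym[of v u] by (simp add: pq brk_right t0 flip: t_def)
    then have "r = 0"
      using t by (simp only: z, simp)
    with pq show ?thesis by simp
  qed
  have ind: "independent4 a b u t"
    unfolding independent4_def
  proof (intro allI impI)
    fix p q r s
    assume *: "smul L p a + smul L q b + smul L r u + smul L s t = 0"
    then have "p = 0 \<and> q = 0 \<and> r = 0"
      by (intro central[of p q r s]) (simp add: brk_right)
    then show "p = 0 \<and> q = 0 \<and> r = 0 \<and> s = 0"
      using * t by simp
  qed
  \<comment> \<open>Every \<open>[w, u]\<close> is central, and by \<open>central\<close> a central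
    vector has only a \<open>t\<close> component.\<close>
  have multiple: "\<exists>k. brk L w u = smul L k t" for w
  proof -
    obtain p q r s where k: "brk L w u = smul L p a + smul L q b + smul L r u + smul L s t"
      using coordinatesE[OF dim ind] by blast
    have "brk L w' (brk L w u) = 0" for w'
      using wu brk_antisym[of w'] by simp
    then have "p = 0 \<and> q = 0 \<and> r = 0"
      unfolding k by (rule central)
    then show ?thesis using k by auto
  qed
  obtain \<alpha> \<beta> where \<alpha>: "brk L a u = smul L \<alpha> t" and \<beta>: "brk L b u = smul L \<beta> t"
    using multiple by metis
  show ?thesis
  proof (cases "\<alpha> = 0")
    case False
    then show ?thesis
      using lie_isomorphic_L43_if_proportional[OF dim ab(1), of "\<beta> / \<alpha>"] t
      by (simp add: \<alpha> \<beta> brk_left t0)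
  next
    case True
    \<comment> \<open>Expanding \<open>v\<close> in \<open>t = [u, v] = -[v, u]\<close> leaves only
      the \<open>b\<close> component, because \<open>a\<close> now commutes with \<open>u\<close>;
      so \<beta> cannot vanish as well.\<close>
    obtain p q r s where "v = smul L p a + smul L q b + smul L r u + smul L s t"
      using coordinatesE[OF dim ind] by blast
    then have "t = - brk L (smul L p a + smul L q b + smul L r u + smul L s t) u"
      using t_def brk_antisym[of u v] by simp
    also have "\<dots> = - smul L (q * \<beta>) t"
      by (simp add: brk_left \<alpha> \<beta> True brk_alternating t0)
    finally have "\<beta> \<noteq> 0" using t by auto
    \<comment> \<open>The pair \<open>b, - a\<close> takes over the roles of \<open>a, b\<close>:
      the sign keeps the product equal to \<open>u\<close>, and \<open>- a\<close> already commutes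
      with \<open>u\<close>, so the factor is 0.\<close>
    then show ?thesis
      using lie_isomorphic_L43_if_proportional[OF dim, of b "- a" u 0] t
      by (simp add: \<alpha> \<beta> True ab brk_left brk_right t0)
  qed
qed

end

section \<open>Completeness of the list and separation of its members\<close>

lemma nilpotent_dim_4_cases:
  assumes "nilpotent_lie_algebra_of_dim 4 L"
  shows "lie_isomorphic L L41 \<or> lie_isomorphic L L42 \<or> lie_isomorphic L L43"
proof -
  interpret lie_algebra L
    using assms by (simp add: nilpotent_lie_algebra_of_dim_def)
  have L: "dim UNIV = 4" "nilpotent"
    using assms by (simp_all add: nilpotent_lie_algebra_of_dim_def)
  show ?thesis
    using lie_isomorphic_L41[OF L(1)] lie_isomorphic_L42_if_class_2[OF L(1)]
      lie_isomorphic_L43_if_class_3[OF L(1)] nilpotent_class_ge_3E[OF L(2)]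
    by metis
qed

text \<open>Arguments in \<open>M\<close> are pulled back along the surjective isomorphism. This
  separates \<open>L41\<close> from the other two algebras.\<close>

lemma brk_zero_if_lie_isomorphic:
  assumes "lie_isomorphic L M" and "lie_algebra L" and "\<And>x y. brk L x y = 0"
  shows "brk M x y = 0"
proof -
  obtain \<phi> where lin: "Vector_Spaces.linear (smul L) (smul M) \<phi>" and "bij \<phi>"
    and hom: "\<And>x y. \<phi> (brk L x y) = brk M (\<phi> x) (\<phi> y)"
    using assms(1) unfolding lie_isomorphic_def by blast
  interpret \<phi>: Vector_Spaces.linear "smul L" "smul M" \<phi> by (rule lin)
  obtain x' y' where "x = \<phi> x'" "y = \<phi> y'"
    using \<open>bij \<phi>\<close> by (metis bij_pointE)
  then show ?thesis
    using hom[of x' y'] by (simp add: assms(3) \<phi>.zero)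
qed

text \<open>The same pullback for double products; it separates \<open>L42\<close> from
  \<open>L43\<close>.\<close>

lemma class_2_if_lie_isomorphic:
  assumes "lie_isomorphic L M" and "lie_algebra L" and "\<And>x y z. brk L (brk L x y) z = 0"
  shows "brk M (brk M x y) z = 0"
proof -
  obtain \<phi> where lin: "Vector_Spaces.linear (smul L) (smul M) \<phi>" and "bij \<phi>"
    and hom: "\<And>x y. \<phi> (brk L x y) = brk M (\<phi> x) (\<phi> y)"
    using assms(1) unfolding lie_isomorphic_def by blast
  interpret \<phi>: Vector_Spaces.linear "smul L" "smul M" \<phi> by (rule lin)
  obtain x' y' z' where "x = \<phi> x'" "y = \<phi> y'" "z = \<phi> z'"
    using \<open>bij \<phi>\<close> by (metis bij_pointE)
  then have "brk M (brk M x y) z = \<phi> (brk L (brk L x' y') z')"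
    by (simp add: hom)
  then show ?thesis
    by (simp add: assms(3) \<phi>.zero)
qed

lemma brk_L42_brk: "brk L42 (brk L42 x y) z = 0"
  by (simp add: prod_eq_iff vec_eq_iff forall_3 brk_L42)

lemma brk_L42_nonzero: "brk L42 (basis_vec 1, 0) (basis_vec 2, 0) \<noteq> 0"
  by (simp add: prod_eq_iff vec_eq_iff forall_3 brk_L42 axis_def)

text \<open>The value is \<open>[e3, e1] = -e4\<close>. It shows that \<open>L43\<close> is neither
  abelian nor of class two, and it is also the violation of the CB condition.\<close>

lemma brk_L43_brk_nonzero:
  "brk L43 (brk L43 (basis_vec 1) (basis_vec 2)) (basis_vec 1) \<noteq> 0"
  by (simp add: vec_eq_iff forall_4 brk_L43 axis_def)

theorem proposition5p2:
  assumes "CHAR('f::field) \<noteq> 2"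
  shows "nilpotent_lie_algebra_of_dim 4 (L41 :: ('f, ('f ^ 3) \<times> 'f) lie_alg) \<and>
    nilpotent_lie_algebra_of_dim 4 (L42 :: ('f, ('f ^ 3) \<times> 'f) lie_alg) \<and>
    nilpotent_lie_algebra_of_dim 4 (L43 :: ('f, 'f ^ 4) lie_alg) \<and>
    (\<forall>L :: ('f, 'v::ab_group_add) lie_alg. nilpotent_lie_algebra_of_dim 4 L \<longrightarrow>
       lie_isomorphic L (L41 :: ('f, ('f ^ 3) \<times> 'f) lie_alg) \<or>
       lie_isomorphic L (L42 :: ('f, ('f ^ 3) \<times> 'f) lie_alg) \<or>
       lie_isomorphic L (L43 :: ('f, 'f ^ 4) lie_alg)) \<and>
    \<not> lie_isomorphic (L41 :: ('f, ('f ^ 3) \<times> 'f) lie_alg) (L42 :: ('f, ('f ^ 3) \<times> 'f) lie_alg) \<and>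
    \<not> lie_isomorphic (L41 :: ('f, ('f ^ 3) \<times> 'f) lie_alg) (L43 :: ('f, 'f ^ 4) lie_alg) \<and>
    \<not> lie_isomorphic (L42 :: ('f, ('f ^ 3) \<times> 'f) lie_alg) (L43 :: ('f, 'f ^ 4) lie_alg) \<and>
    lie_algebra.CB (L41 :: ('f, ('f ^ 3) \<times> 'f) lie_alg) \<and>
    lie_algebra.CB (L42 :: ('f, ('f ^ 3) \<times> 'f) lie_alg) \<and>
    \<not> lie_algebra.CB (L43 :: ('f, 'f ^ 4) lie_alg)"
proof (intro conjI allI impI notI)
  show "lie_isomorphic L L41 \<or> lie_isomorphic L L42 \<or> lie_isomorphic L L43"
    if "nilpotent_lie_algebra_of_dim 4 L" for L :: "('f, 'v) lie_alg"
    using that by (rule nilpotent_dim_4_cases)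
  show False
    if "lie_isomorphic (L41 :: ('f, ('f ^ 3) \<times> 'f) lie_alg) (L42 :: ('f, ('f ^ 3) \<times> 'f) lie_alg)"
    using brk_zero_if_lie_isomorphic[OF that lie_algebra_models(1) brk_L41] brk_L42_nonzero by blast
  show False
    if "lie_isomorphic (L41 :: ('f, ('f ^ 3) \<times> 'f) lie_alg) (L43 :: ('f, 'f ^ 4) lie_alg)"
    using brk_zero_if_lie_isomorphic[OF that lie_algebra_models(1) brk_L41] brk_L43_brk_nonzero by blast
  show False
    if "lie_isomorphic (L42 :: ('f, ('f ^ 3) \<times> 'f) lie_alg) (L43 :: ('f, 'f ^ 4) lie_alg)"
    using class_2_if_lie_isomorphic[OF that lie_algebra_models(2) brk_L42_brk] brk_L43_brk_nonzero
    by blast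
  show "lie_algebra.CB (L41 :: ('f, ('f ^ 3) \<times> 'f) lie_alg)"
    by (simp add: lie_algebra.CB_def[OF lie_algebra_models(1)] brk_L41)
  \<comment> \<open>The conclusion of the CB condition is itself a double product, hence
    zero.\<close>
  show "lie_algebra.CB (L42 :: ('f, ('f ^ 3) \<times> 'f) lie_alg)"
    by (simp add: lie_algebra.CB_def[OF lie_algebra_models(2)] brk_L42_brk)
  show False
    if "lie_algebra.CB (L43 :: ('f, 'f ^ 4) lie_alg)"
    using that brk_L43_brk_nonzero lie_algebra.brk_alternating[OF lie_algebra_models(3)]
    unfolding lie_algebra.CB_def[OF lie_algebra_models(3)] by blast
qed (rule nilpotent_models)+

end
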